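(* Let $A:X\to Y^*$ be a linear operator and $C\subseteq X$, $K\subseteq Y$ closed convex cones. Consider the game $G=(\alpha,\beta,A)$ for some $\alpha\in\mathrm{int}\,C^*$, $\beta\in\mathrm{int}\,K^*$, and let $v$ be its value. Then $v\ne0$ if and only if exactly one of the following is true: (i) there exists $y\in K\setminus\{0\}$ such that $-A^*y\in\mathrm{int}\,C^*$; (ii) there exists $x\in C\setminus\{0\}$ such that $Ax\in\mathrm{int}\,K^*$.
   Context: $X$ and $Y$ are real reflexive Banach spaces with continuous duals $X^*$, $Y^*$; $\langle w,x\rangle$ ($w\in X^*,x\in X$) and $\langle y,z\rangle$ ($y\in Y,z\in Y^*$) are the canonical pairings; all spaces carry their norm topologies. A convex cone is a set $C$ with $\lambda C\subseteq C$ for all $\lambda\ge0$ and $\kappa C+(1-\kappa)C\subseteq C$ for all $\kappa\in[0,1]$. $C^*=\{w\in X^*:\langle w,x\rangle\ge0\ \forall x\in C\}$, $K^*=\{z\in Y^*:\langle y,z\rangle\ge0\ \forall y\in K\}$; both are assumed to have non-empty interior. The linear operator $A$ is assumed to have an adjoint: for every $y\in Y$ there is a unique $A^*y\in X^*$ with $\langle A^*y,x\rangle=\langle y,Ax\rangle$ for all $x\in X$. The game $G=(\alpha,\beta,A)$ is the two-player zero-sum game with (non-empty) strategy sets $S=\{x\in C:\langle\alpha,x\rangle=1\}$, $T=\{y\in K:\langle y,\beta\rangle=1\}$ and payoff $u(x,y)=\langle y,Ax\rangle$, maximized by player I over $S$ and minimized by player II over $T$, with finite lower and upper values. Its value is $v=\sup_{x\in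 S}\inf_{y\in T}u(x,y)=\inf_{y\in T}\sup_{x\in S}u(x,y)$ (it exists in this setting). *)

theory Defs
  imports "HOL-Analysis.Analysis"
begin

text \<open>
  The continuous dual of a real normed space \<open>'a\<close> is the type \<open>'a \<Rightarrow>\<^sub>L real\<close> with the operator norm.
  Both canonical pairings are function application: \<open>\<langle>w, x\<rangle>\<close> is \<open>blinfun_apply w x\<close>, and
  \<open>\<langle>y, z\<rangle>\<close>, with the functional on the right, is \<open>blinfun_apply z y\<close>.
\<close>

definition bidual_embedding :: "'a::real_normed_vector \<Rightarrow> (('a \<Rightarrow>\<^sub>L real) \<Rightarrow>\<^sub>L real)" where
  "bidual_embedding x = Blinfun (\<lambda>f. blinfun_apply f x)"

lemma bidual_embedding_apply [simp]:
  "blinfun_apply (bidual_embedding x) f = blinfun_apply f x"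
  unfolding bidual_embedding_def
  by (simp add: bounded_linear_Blinfun_apply blinfun.bounded_linear_left)

definition reflexive_space :: "'a::real_normed_vector itself \<Rightarrow> bool" where
  "reflexive_space _ \<longleftrightarrow> surj (bidual_embedding :: 'a \<Rightarrow> (('a \<Rightarrow>\<^sub>L real) \<Rightarrow>\<^sub>L real))"

definition dual_cone :: "'a::real_normed_vector set \<Rightarrow> ('a \<Rightarrow>\<^sub>L real) set" where
  "dual_cone C = {w. \<forall>x\<in>C. blinfun_apply w x \<ge> 0}"

definition has_dual_adjoint ::
  "('a::real_normed_vector \<Rightarrow> ('b::real_normed_vector \<Rightarrow>\<^sub>L real)) \<Rightarrow> bool" where
  "has_dual_adjoint A \<longleftrightarrow>
     (\<forall>y. \<exists>!w :: 'a \<Rightarrow>\<^sub>L real. \<forall>x. blinfun_apply w x = blinfun_apply (A x) y)"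

text \<open>Meaningful only under \<open>has_dual_adjoint A\<close>.\<close>

definition dual_adjoint ::
  "('a::real_normed_vector \<Rightarrow> ('b::real_normed_vector \<Rightarrow>\<^sub>L real)) \<Rightarrow> 'b \<Rightarrow> ('a \<Rightarrow>\<^sub>L real)" where
  "dual_adjoint A y = (THE w. \<forall>x. blinfun_apply w x = blinfun_apply (A x) y)"

definition strategies :: "'a::real_normed_vector set \<Rightarrow> ('a \<Rightarrow>\<^sub>L real) \<Rightarrow> 'a set" where
  "strategies C f = {x \<in> C. blinfun_apply f x = 1}"

definition payoff ::
  "('a::real_normed_vector \<Rightarrow> ('b::real_normed_vector \<Rightarrow>\<^sub>L real)) \<Rightarrow> 'a \<Rightarrow> 'b \<Rightarrow> real" where
  "payoff A x y = blinfun_apply (A x) y"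

text \<open>
  Suprema and infima are taken in the extended reals, because \<open>Sup\<close> and \<open>Inf\<close> on \<open>real\<close> are
  unspecified for unbounded sets.
\<close>

definition lower_value :: "'a set \<Rightarrow> 'b set \<Rightarrow> ('a \<Rightarrow> 'b \<Rightarrow> real) \<Rightarrow> ereal" where
  "lower_value S T u = (SUP x\<in>S. INF y\<in>T. ereal (u x y))"

definition upper_value :: "'a set \<Rightarrow> 'b set \<Rightarrow> ('a \<Rightarrow> 'b \<Rightarrow> real) \<Rightarrow> ereal" where
  "upper_value S T u = (INF y\<in>T. SUP x\<in>S. ereal (u x y))"

text \<open>As \<open>v\<close> is real, this includes finiteness of the lower and upper values.\<close>

definition is_game_value :: "'a set \<Rightarrow> 'b set \<Rightarrow> ('a \<Rightarrow> 'b \<Rightarrow> real) \<Rightarrow> real \<Rightarrow> bool" where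
  "is_game_value S T u v \<longleftrightarrow> lower_value S T u = ereal v \<and> upper_value S T u = ereal v"

end

theory Submission
  imports Defs
begin

text \<open>
  The sign of the value decides between the alternatives: \<open>v > 0\<close> is equivalent to (ii), and
  \<open>v < 0\<close> to (i), so that exactly one of them holds if \<open>v \<noteq> 0\<close> and neither if \<open>v = 0\<close>.

  For the first equivalence, fix \<open>\<beta>\<close> in the interior of \<open>K\<^sup>*\<close>. A functional is interior to \<open>K\<^sup>*\<close> if
  and only if it dominates \<open>\<delta> \<beta>\<close> on \<open>K\<close> for some \<open>\<delta> > 0\<close> (\<open>interior_dual_cone_iff\<close>). Since
  \<open>\<beta> = 1\<close> on the strategies of player II, \<open>A x\<close> is interior to \<open>K\<^sup>*\<close> just when the payoffs of \<open>x\<close>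
  are bounded below by a positive constant; where \<open>\<beta>\<close> vanishes on \<open>K\<close>, so does every continuous
  functional, because \<open>\<beta>\<close> is interior (\<open>interior_dual_cone_eq_0\<close>). The only delicate point is
  that \<open>x \<in> C\<close> with \<open>A x\<close> interior can be rescaled to a strategy, i.e. that \<open>\<alpha> x > 0\<close>.
  If \<open>\<alpha> x = 0\<close>, then every continuous functional vanishes at \<open>x\<close> by the same lemma, since \<open>\<alpha>\<close> is
  interior to \<open>C\<^sup>*\<close>; in particular \<open>A\<^sup>* y\<close> does, so the payoff of \<open>x\<close> against any strategy \<open>y\<close> is zero, which contradicts the lower
  bound. The second equivalence is the first one for the game with the players exchanged and
  operator \<open>-A\<^sup>*\<close>, whose lower value is the negative of the original upper value.
\<close>

text \<open>An interior point of a set can be moved a little in any prescribed direction.\<close>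

lemma interior_move_in_direction:
  fixes w g :: "'a::real_normed_vector"
  assumes "w \<in> interior D"
  obtains t where "t > 0" "w + t *\<^sub>R g \<in> D"
proof -
  obtain e where e: "e > 0" "ball w e \<subseteq> D"
    using assms mem_interior by blast
  define t where "t = e / (norm g + 1)"
  have pos: "norm g + 1 > 0"
    by (simp add: add_nonneg_pos)
  have "t * norm g < e"
    using e(1) pos by (simp add: t_def field_simps)
  moreover have "t > 0"
    using e(1) pos by (simp add: t_def)
  ultimately have "w + t *\<^sub>R g \<in> ball w e"
    by (simp add: dist_norm)
  with \<open>t > 0\<close> e(2) that show thesis by blast
qed

lemma interior_dual_cone_iff:
  fixes C :: "'a::real_normed_vector set"
  assumes \<alpha>: "\<alpha> \<in> interior (dual_cone C)"
  shows "w \<in> interior (dual_cone C) \<longleftrightarrow>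
    (\<exists>\<delta>>0. \<forall>x\<in>C. \<delta> * blinfun_apply \<alpha> x \<le> blinfun_apply w x)"
proof
  assume "w \<in> interior (dual_cone C)"
  then obtain t where "t > 0" "w + t *\<^sub>R (- \<alpha>) \<in> dual_cone C"
    by (rule interior_move_in_direction)
  then show "\<exists>\<delta>>0. \<forall>x\<in>C. \<delta> * blinfun_apply \<alpha> x \<le> blinfun_apply w x"
    by (auto simp: dual_cone_def blinfun.bilinear_simps intro!: exI[of _ t])
next
  assume "\<exists>\<delta>>0. \<forall>x\<in>C. \<delta> * blinfun_apply \<alpha> x \<le> blinfun_apply w x"
  then obtain \<delta> where \<delta>: "\<delta> > 0"
    and le: "\<And>x. x \<in> C \<Longrightarrow> \<delta> * blinfun_apply \<alpha> x \<le> blinfun_apply w x"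
    by blast
  obtain e where e: "e > 0" "ball \<alpha> e \<subseteq> dual_cone C"
    using \<alpha> mem_interior by blast
  have "ball w (\<delta> * e) \<subseteq> dual_cone C"
  proof
    fix g assume g: "g \<in> ball w (\<delta> * e)"
    \<comment> \<open>Write \<open>g\<close> as \<open>(w - \<delta> \<alpha>) + \<delta> k\<close>, with \<open>k\<close> near \<open>\<alpha>\<close>; both summands lie in the dual cone.\<close>
    define d where "d = (1 / \<delta>) *\<^sub>R (g - w)"
    define k where "k = \<alpha> + d"
    have "norm d = norm (g - w) / \<delta>"
      unfolding d_def norm_scaleR using \<delta> by simp
    moreover have "norm (g - w) < \<delta> * e"
      using g by (simp add: dist_norm norm_minus_commute)
    ultimately have "norm d < e"
      using \<delta> by (simp add: pos_divide_less_eq mult.commute)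
    then have "k \<in> ball \<alpha> e"
      by (simp add: k_def dist_norm)
    then have k: "0 \<le> blinfun_apply k x" if "x \<in> C" for x
      using e(2) that by (auto simp: dual_cone_def)
    have "g = (w - \<delta> *\<^sub>R \<alpha>) + \<delta> *\<^sub>R k"
      using \<delta> by (simp add: k_def d_def algebra_simps)
    then have eq: "blinfun_apply g x =
        (blinfun_apply w x - \<delta> * blinfun_apply \<alpha> x) + \<delta> * blinfun_apply k x" for x
      by (simp add: blinfun.bilinear_simps)
    have "0 \<le> blinfun_apply g x" if "x \<in> C" for x
      using le[OF that] k[OF that] \<delta> by (simp add: eq)
    then show "g \<in> dual_cone C"
      by (simp add: dual_cone_def)
  qed
  then show "w \<in> interior (dual_cone C)"
    using \<delta> e(1) by (auto simp: mem_interior intro!: exI[of _ "\<delta> * e"])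
qed

lemma interior_dual_cone_eq_0:
  fixes C :: "'a::real_normed_vector set" and g :: "'a \<Rightarrow>\<^sub>L real"
  assumes \<alpha>: "\<alpha> \<in> interior (dual_cone C)" and x: "x \<in> C" and 0: "blinfun_apply \<alpha> x = 0"
  shows "blinfun_apply g x = 0"
proof -
  have nonneg: "0 \<le> blinfun_apply h x" for h :: "'a \<Rightarrow>\<^sub>L real"
  proof -
    obtain t where "t > 0" "\<alpha> + t *\<^sub>R h \<in> dual_cone C"
      using \<alpha> by (rule interior_move_in_direction)
    then have "0 \<le> t * blinfun_apply h x"
      using x 0 by (auto simp: dual_cone_def blinfun.bilinear_simps)
    then show ?thesis
      using \<open>t > 0\<close> by (simp add: zero_le_mult_iff)
  qed
  show ?thesis
    using nonneg[of g] nonneg[of "- g"] by (simp add: blinfun.bilinear_simps)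
qed

text \<open>
  No value is required to exist here, so that the lemma applies to either player. The adjoint only
  enters through the continuity of \<open>x \<mapsto> \<langle>y, A x\<rangle>\<close> for each \<open>y\<close>.
\<close>

lemma lower_value_pos_iff:
  fixes A :: "'a::real_normed_vector \<Rightarrow> ('b::real_normed_vector \<Rightarrow>\<^sub>L real)"
  assumes lin: "linear A"
    and adj: "\<And>y. \<exists>w :: 'a \<Rightarrow>\<^sub>L real. \<forall>x. blinfun_apply w x = blinfun_apply (A x) y"
    and C: "cone C" and K: "cone K"
    and \<alpha>: "\<alpha> \<in> interior (dual_cone C)" and \<beta>: "\<beta> \<in> interior (dual_cone K)"
    and T: "strategies K \<beta> \<noteq> {}"
  shows "0 < lower_value (strategies C \<alpha>) (strategies K \<beta>) (payoff A) \<longleftrightarrow>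
    (\<exists>x \<in> C - {0}. A x \<in> interior (dual_cone K))"
proof
  assume "0 < lower_value (strategies C \<alpha>) (strategies K \<beta>) (payoff A)"
  then obtain x where x: "x \<in> strategies C \<alpha>"
    and "0 < (INF y\<in>strategies K \<beta>. ereal (payoff A x y))"
    by (auto simp: lower_value_def less_SUP_iff)
  then obtain c where c: "c > 0" "ereal c < (INF y\<in>strategies K \<beta>. ereal (payoff A x y))"
    using ereal_dense2[of 0] by (auto simp: zero_ereal_def)
  have bound: "c \<le> blinfun_apply (A x) y" if "y \<in> strategies K \<beta>" for y
    using less_INF_D[OF c(2) that] by (simp add: payoff_def)
  have "c * blinfun_apply \<beta> y \<le> blinfun_apply (A x) y" if y: "y \<in> K" for y
  proof (cases "blinfun_apply \<beta> y = 0")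
    case True
    then show ?thesis
      using interior_dual_cone_eq_0[OF \<beta> y] by simp
  next
    case False
    moreover have "0 \<le> blinfun_apply \<beta> y"
      using \<beta> interior_subset y by (fastforce simp: dual_cone_def)
    ultimately have pos: "blinfun_apply \<beta> y > 0" by simp
    have "(1 / blinfun_apply \<beta> y) *\<^sub>R y \<in> strategies K \<beta>"
      using pos y K by (simp add: strategies_def cone_def blinfun.bilinear_simps)
    from bound[OF this] pos show ?thesis
      by (simp add: blinfun.bilinear_simps field_simps)
  qed
  then have "A x \<in> interior (dual_cone K)"
    using c(1) interior_dual_cone_iff[OF \<beta>] by blast
  moreover have "x \<in> C - {0}"
    using x by (auto simp: strategies_def)
  ultimately show "\<exists>x \<in> C - {0}. A x \<in> interior (dual_cone K)" by blast
next
  assume "\<exists>x \<in> C - {0}. A x \<in> interior (dual_cone K)"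
  then obtain x where x: "x \<in> C" and "A x \<in> interior (dual_cone K)" by blast
  then obtain \<delta> where \<delta>: "\<delta> > 0"
    and le: "\<And>y. y \<in> K \<Longrightarrow> \<delta> * blinfun_apply \<beta> y \<le> blinfun_apply (A x) y"
    using interior_dual_cone_iff[OF \<beta>] by blast
  have bound: "\<delta> \<le> blinfun_apply (A x) y" if "y \<in> strategies K \<beta>" for y
    using le[of y] that by (simp add: strategies_def)
  have "blinfun_apply \<alpha> x \<noteq> 0"
  proof
    assume 0: "blinfun_apply \<alpha> x = 0"
    obtain y where y: "y \<in> strategies K \<beta>" using T by blast
    obtain w :: "'a \<Rightarrow>\<^sub>L real" where "blinfun_apply w x = blinfun_apply (A x) y"
      using adj by blast
    with bound[OF y] \<delta> interior_dual_cone_eq_0[OF \<alpha> x 0, of w] show False by simp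
  qed
  moreover have "0 \<le> blinfun_apply \<alpha> x"
    using \<alpha> interior_subset x by (fastforce simp: dual_cone_def)
  ultimately have pos: "blinfun_apply \<alpha> x > 0" by simp
  define x' where "x' = (1 / blinfun_apply \<alpha> x) *\<^sub>R x"
  have x': "x' \<in> strategies C \<alpha>"
    using pos x C by (simp add: x'_def strategies_def cone_def blinfun.bilinear_simps)
  have "\<delta> / blinfun_apply \<alpha> x \<le> payoff A x' y" if "y \<in> strategies K \<beta>" for y
    using bound[OF that] pos
    by (simp add: payoff_def x'_def linear_cmul[OF lin] blinfun.bilinear_simps divide_right_mono)
  then have "ereal (\<delta> / blinfun_apply \<alpha> x) \<le> (INF y\<in>strategies K \<beta>. ereal (payoff A x' y))"
    by (intro INF_greatest) simp
  also have "\<dots> \<le> lower_value (strategies C \<alpha>) (strategies K \<beta>) (payoff A)"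
    unfolding lower_value_def using x' by (rule SUP_upper)
  finally show "0 < lower_value (strategies C \<alpha>) (strategies K \<beta>) (payoff A)"
    using pos \<delta> by (smt (verit) divide_pos_pos ereal_less(2) less_le_trans)
qed

lemma lower_value_exchange:
  assumes "\<And>x y. u' y x = - u x y"
  shows "lower_value T S u' = - upper_value S T u"
  by (simp add: lower_value_def upper_value_def assms ereal_INF_uminus_eq ereal_SUP_uminus_eq
      flip: uminus_ereal.simps)

lemma dual_adjoint_apply:
  assumes "has_dual_adjoint A"
  shows "blinfun_apply (dual_adjoint A y) x = blinfun_apply (A x) y"
proof -
  have "\<exists>!w. \<forall>x. blinfun_apply w x = blinfun_apply (A x) y"
    using assms by (simp add: has_dual_adjoint_def)
  from theI'[OF this] show ?thesis
    by (simp add: dual_adjoint_def)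
qed

theorem lemma4p1:
  fixes A :: "'a::banach \<Rightarrow> ('b::banach \<Rightarrow>\<^sub>L real)"
    and C :: "'a set" and K :: "'b set"
    and \<alpha> :: "'a \<Rightarrow>\<^sub>L real" and \<beta> :: "'b \<Rightarrow>\<^sub>L real"
    and v :: real
  assumes "reflexive_space TYPE('a)" and "reflexive_space TYPE('b)"
    and "linear A" and "has_dual_adjoint A"
    and "closed C" and "convex C" and "cone C"
    and "closed K" and "convex K" and "cone K"
    and "\<alpha> \<in> interior (dual_cone C)" and "\<beta> \<in> interior (dual_cone K)"
    and "strategies C \<alpha> \<noteq> {}" and "strategies K \<beta> \<noteq> {}"
    and "is_game_value (strategies C \<alpha>) (strategies K \<beta>) (payoff A) v"
  shows "v \<noteq> 0 \<longleftrightarrow>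
    (let P = (\<exists>y \<in> K - {0}. - dual_adjoint A y \<in> interior (dual_cone C));
         Q = (\<exists>x \<in> C - {0}. A x \<in> interior (dual_cone K))
     in (P \<and> \<not> Q) \<or> (\<not> P \<and> Q))"
proof -
  note adj = dual_adjoint_apply[OF \<open>has_dual_adjoint A\<close>]
  have Q: "(\<exists>x \<in> C - {0}. A x \<in> interior (dual_cone K)) \<longleftrightarrow> v > 0"
  proof -
    have "\<exists>w. \<forall>x. blinfun_apply w x = blinfun_apply (A x) y" for y
      using adj by blast
    from lower_value_pos_iff[OF \<open>linear A\<close> this \<open>cone C\<close> \<open>cone K\<close> assms(11,12,14)]
    show ?thesis
      using assms(15) by (simp add: is_game_value_def)
  qed
  have P: "(\<exists>y \<in> K - {0}. - dual_adjoint A y \<in> interior (dual_cone C)) \<longleftrightarrow> v < 0"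
  proof -
    let ?B = "\<lambda>y. - dual_adjoint A y"
    have "linear ?B"
      by (rule linearI; rule blinfun_eqI) (simp_all add: adj blinfun.bilinear_simps)
    moreover have "\<exists>w. \<forall>y. blinfun_apply w y = blinfun_apply (?B y) x" for x
      by (rule exI[of _ "- A x"]) (simp add: adj blinfun.bilinear_simps)
    ultimately have "0 < lower_value (strategies K \<beta>) (strategies C \<alpha>) (payoff ?B) \<longleftrightarrow>
        (\<exists>y \<in> K - {0}. ?B y \<in> interior (dual_cone C))"
      by (rule lower_value_pos_iff[OF _ _ \<open>cone K\<close> \<open>cone C\<close> assms(12,11,13)])
    moreover have "lower_value (strategies K \<beta>) (strategies C \<alpha>) (payoff ?B) =
        - upper_value (strategies C \<alpha>) (strategies K \<beta>) (payoff A)"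
      by (rule lower_value_exchange) (simp add: payoff_def adj blinfun.bilinear_simps)
    ultimately show ?thesis
      using assms(15) by (simp add: is_game_value_def)
  qed
  show ?thesis
    unfolding P Q Let_def by linarith
qed

end
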